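(* Let $n\geq 1$, let $C_n$ be the multiplicative cyclic group of order $n$ generated by $x$, let $\zeta=e^{2\pi i/n}$ (with $i$ here the imaginary unit), and let $$T_{C_n}=\sum_{\substack{a,b,c\in\mathbb{Z}/n\mathbb{Z}\\ a+b+c=0}} x^a\otimes x^b\otimes x^c\in\mathbb{C}C_n\otimes\mathbb{C}C_n\otimes\mathbb{C}C_n.$$ Then the decomposition $$T_{C_n}=\sum_{t=0}^{n-1}\sqrt{n}\,\Big(\tfrac{1}{\sqrt n}\sum_{a=0}^{n-1}\zeta^{ta}x^a\Big)\otimes\Big(\tfrac{1}{\sqrt n}\sum_{b=0}^{n-1}\zeta^{tb}x^b\Big)\otimes\Big(\tfrac{1}{\sqrt n}\sum_{c=0}^{n-1}\zeta^{tc}x^c\Big)$$ is the unique (up to the order of the summands) diagonal singular value decomposition of $T_{C_n}$. In particular, the singular values of $T_{C_n}$ are $\underbrace{\sqrt n,\sqrt n,\dots,\sqrt n}_{n}$, and $\|T_{C_n}\|_\star=n\sqrt n$.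
   Context: The group algebra $\mathbb{C}C_n$ is the Hilbert space with orthonormal basis the group elements $x^0,\dots,x^{n-1}$. For a tensor product $V=V^{(1)}\otimes\cdots\otimes V^{(d)}$ of finite dimensional Hilbert spaces (with the induced Hermitian form), a pure tensor is an element of the form $v^{(1)}\otimes\cdots\otimes v^{(d)}$ with $v^{(e)}\in V^{(e)}$. The nuclear norm $\|T\|_\star$ of $T\in V$ is the smallest possible value of $\sum_{i=1}^m\|v_i\|$ over all decompositions $T=\sum_{i=1}^m v_i$ ($m$ arbitrary) into pure tensors. For a tuple $\mathbf{S}=(S_1,\dots,S_m)$ of tensors in $V$ and $\alpha>0$, $[\mathbf{S}]_\alpha$ is the maximum of $\big(\sum_{i=1}^m|\langle S_i,u\rangle|^\alpha\big)^{1/\alpha}$ over all pure tensors $u\in V$ of unit length. For real $t\geq 1$, a tuple $\mathbf{S}$ of tensors of unit length is called $t$-orthogonal if $[\mathbf{S}]_{2/t}=1$. A diagonal singular value decomposition of $T\in V$ is a decomposition $T=\sum_{i=1}^m\sigma_iv_i$ where $\sigma_1\geq\cdots\geq\sigma_m>0$ are real and $(v_1,\dots,v_m)$ is a $2$-orthogonal tuple of pure tensors of unit length; $\sigma_1,\dots,\sigma_m$ are called the singular values (they are uniquely determined by $T$). *)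

theory Defs
  imports Complex_Main "HOL-Library.Multiset" "HOL-Algebra.Generated_Groups"
begin

text \<open>
  A finite dimensional Hilbert space is given by a finite set \<open>B\<close> indexing an orthonormal basis; its
  vectors are the coordinate functions on \<open>B\<close>. The tensor product \<open>V\<close> of the spaces with bases
  \<open>B\<^sub>1, \<dots>, B\<^sub>d\<close> is given by the list \<open>Bs = [B\<^sub>1, \<dots>, B\<^sub>d]\<close>: its orthonormal basis is indexed by
  \<open>listset Bs\<close>, the set of all \<open>[b\<^sub>1, \<dots>, b\<^sub>d]\<close> with \<open>b\<^sub>e \<in> B\<^sub>e\<close>, and a tensor is its coordinate
  function, required to be \<open>0\<close> outside \<open>listset Bs\<close> so that equality of tensors is equality of
  functions. The sets in \<open>Bs\<close> are meant to be finite and nonempty.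
\<close>

type_synonym 'b tensor = "'b list \<Rightarrow> complex"

definition tensor_space :: "'b set list \<Rightarrow> 'b tensor set" where
  "tensor_space Bs = {T. \<forall>is. is \<notin> listset Bs \<longrightarrow> T is = 0}"

definition tensor_inner :: "'b set list \<Rightarrow> 'b tensor \<Rightarrow> 'b tensor \<Rightarrow> complex" where
  "tensor_inner Bs S T = (\<Sum>is\<in>listset Bs. S is * cnj (T is))"

definition tensor_norm :: "'b set list \<Rightarrow> 'b tensor \<Rightarrow> real" where
  "tensor_norm Bs T = sqrt (Re (tensor_inner Bs T T))"

definition tensor_prod :: "'b set list \<Rightarrow> ('b \<Rightarrow> complex) list \<Rightarrow> 'b tensor" where
  "tensor_prod Bs vs =
     (\<lambda>is. if is \<in> listset Bs then prod_list (map2 (\<lambda>v b. v b) vs is) else 0)"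

definition pure_tensors :: "'b set list \<Rightarrow> 'b tensor set" where
  "pure_tensors Bs = {tensor_prod Bs vs | vs. length vs = length Bs}"

text \<open>
  The infimum is over a nonempty set of nonnegative reals; by compactness it is a minimum.
\<close>

definition nuclear_norm :: "'b set list \<Rightarrow> 'b tensor \<Rightarrow> real" where
  "nuclear_norm Bs T =
     Inf {(\<Sum>v\<leftarrow>vs. tensor_norm Bs v) | vs.
            set vs \<subseteq> pure_tensors Bs \<and> T = (\<lambda>is. \<Sum>v\<leftarrow>vs. v is)}"

text \<open>
  \<open>bracket_norm Bs \<alpha> Ss\<close> is \<open>[S]\<^sub>\<alpha>\<close>. The unit pure tensors form a nonempty compact set, so the
  supremum is a maximum. For \<open>\<alpha> > 0\<close> the library convention \<open>0 powr \<alpha> = 0\<close> is the right one.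
\<close>

definition bracket_norm :: "'b set list \<Rightarrow> real \<Rightarrow> 'b tensor list \<Rightarrow> real" where
  "bracket_norm Bs \<alpha> Ss =
     Sup {(\<Sum>S\<leftarrow>Ss. cmod (tensor_inner Bs S u) powr \<alpha>) powr (1 / \<alpha>) | u.
            u \<in> pure_tensors Bs \<and> tensor_norm Bs u = 1}"

text \<open>Only meant for \<open>t \<ge> 1\<close>.\<close>

definition t_orthogonal :: "'b set list \<Rightarrow> real \<Rightarrow> 'b tensor list \<Rightarrow> bool" where
  "t_orthogonal Bs t Ss \<longleftrightarrow>
     (\<forall>S\<in>set Ss. S \<in> tensor_space Bs \<and> tensor_norm Bs S = 1) \<and> bracket_norm Bs (2 / t) Ss = 1"

text \<open>
  A diagonal singular value decomposition is recorded as the list of the pairs \<open>(\<sigma>\<^sub>i, v\<^sub>i)\<close>.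
\<close>

definition diagonal_svd :: "'b set list \<Rightarrow> 'b tensor \<Rightarrow> (real \<times> 'b tensor) list \<Rightarrow> bool" where
  "diagonal_svd Bs T D \<longleftrightarrow>
     T = (\<lambda>is. \<Sum>(\<sigma>, v)\<leftarrow>D. of_real \<sigma> * v is) \<and>
     sorted_wrt (\<ge>) (map fst D) \<and>
     (\<forall>\<sigma>\<in>set (map fst D). \<sigma> > 0) \<and>
     set (map snd D) \<subseteq> pure_tensors Bs \<and>
     t_orthogonal Bs 2 (map snd D)"

text \<open>
  Well defined when \<open>T\<close> has a diagonal singular value decomposition, as the \<open>\<sigma>\<^sub>i\<close> do not depend on
  the choice of the decomposition.
\<close>

definition singular_values :: "'b set list \<Rightarrow> 'b tensor \<Rightarrow> real list" where
  "singular_values Bs T = (THE \<sigma>s. \<exists>D. diagonal_svd Bs T D \<and> \<sigma>s = map fst D)"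

text \<open>
  The group algebra of \<open>G\<close> has the orthonormal basis \<open>carrier G\<close>; \<open>basis_vec g\<close> is the group element
  \<open>g\<close> as a vector.
\<close>

definition basis_vec :: "'b \<Rightarrow> 'b \<Rightarrow> complex" where
  "basis_vec g = (\<lambda>h. if h = g then 1 else 0)"

abbreviation group_algebra_cube :: "('b, 'c) monoid_scheme \<Rightarrow> 'b set list" where
  "group_algebra_cube G \<equiv> [carrier G, carrier G, carrier G]"

text \<open>
  Classes in \<open>\<int>/n\<int>\<close> are represented by \<open>0, \<dots>, n - 1\<close>, where \<open>n\<close> is the order of \<open>G\<close> and \<open>x\<close> a generator.
\<close>

definition cyclic_tensor :: "('b, 'c) monoid_scheme \<Rightarrow> 'b \<Rightarrow> nat \<Rightarrow> 'b tensor" where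
  "cyclic_tensor G x n =
     (\<lambda>is. \<Sum>(a, b, c) \<in> {(a, b, c). a < n \<and> b < n \<and> c < n \<and> (a + b + c) mod n = 0}.
        tensor_prod (group_algebra_cube G)
          [basis_vec (x [^]\<^bsub>G\<^esub> a), basis_vec (x [^]\<^bsub>G\<^esub> b), basis_vec (x [^]\<^bsub>G\<^esub> c)] is)"

definition root_of_unity :: "nat \<Rightarrow> complex" where
  "root_of_unity n = exp (2 * of_real pi * \<i> / of_nat n)"

definition fourier_vec :: "('b, 'c) monoid_scheme \<Rightarrow> 'b \<Rightarrow> nat \<Rightarrow> nat \<Rightarrow> 'b \<Rightarrow> complex" where
  "fourier_vec G x n t =
     (\<lambda>g. 1 / of_real (sqrt (real n)) *
            (\<Sum>a<n. root_of_unity n ^ (t * a) * basis_vec (x [^]\<^bsub>G\<^esub> a) g))"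

definition fourier_decomposition ::
    "('b, 'c) monoid_scheme \<Rightarrow> 'b \<Rightarrow> nat \<Rightarrow> (real \<times> 'b tensor) list" where
  "fourier_decomposition G x n =
     map (\<lambda>t. (sqrt (real n),
                tensor_prod (group_algebra_cube G)
                  [fourier_vec G x n t, fourier_vec G x n t, fourier_vec G x n t])) [0..<n]"

end

theory Submission imports Defs "HOL-Analysis.L2_Norm" "HOL-Algebra.Multiplicative_Group" begin

text \<open>
  The Fourier vectors \<open>e\<^sub>t\<close> are orthonormal, so \<open>T = \<Sum>\<^sub>t s w\<^sub>t\<close> with \<open>w\<^sub>t = e\<^sub>t \<otimes> e\<^sub>t \<otimes> e\<^sub>t\<close> and
  \<open>s = sqrt n\<close>. For a pure tensor \<open>v\<close>, Bessel and Cauchy--Schwarz give \<open>\<Sum>\<^sub>t \<bar>\<langle>w\<^sub>t, v\<rangle>\<bar> \<le> \<parallel>v\<parallel>\<close>. This makes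
  the \<open>w\<^sub>t\<close> 2-orthogonal, and pairing a decomposition of \<open>T\<close> with \<open>\<Sum>\<^sub>t w\<^sub>t\<close> bounds the nuclear norm from
  below. For a unit pure \<open>v\<close>, \<open>\<Sum>\<^sub>t \<langle>w\<^sub>t, v\<rangle> = 1\<close> forces \<open>v\<close> to be one of the \<open>w\<^sub>t\<close>.

  Let \<open>T = \<Sum>\<^sub>i \<sigma>\<^sub>i v\<^sub>i\<close> be any diagonal singular value decomposition. Testing 2-orthogonality on \<open>v\<^sub>i\<close>
  itself shows that the \<open>v\<^sub>i\<close> are orthonormal, so \<open>\<sigma>\<^sub>i = \<langle>T, v\<^sub>i\<rangle> = s \<Sum>\<^sub>t \<langle>w\<^sub>t, v\<^sub>i\<rangle> \<le> s\<close>, with equality only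
  if \<open>v\<^sub>i\<close> is some \<open>w\<^sub>t\<close>. Testing it on \<open>w\<^sub>t\<close> turns \<open>s = \<langle>T, w\<^sub>t\<rangle> = \<Sum>\<^sub>i \<sigma>\<^sub>i \<langle>v\<^sub>i, w\<^sub>t\<rangle> \<le> s\<close> into an
  equality, so \<open>w\<^sub>t\<close> occurs among the \<open>v\<^sub>i\<close>. Any other \<open>v\<^sub>i\<close> is orthogonal to all \<open>w\<^sub>t\<close>, hence has
  \<open>\<sigma>\<^sub>i = 0\<close>, which is excluded.
\<close>

section \<open>Tensors\<close>

lemma tensor_norm_eq_L2_set: "tensor_norm Bs T = L2_set (\<lambda>is. cmod (T is)) (listset Bs)"
  by (simp add: tensor_norm_def tensor_inner_def L2_set_def complex_mult_cnj cmod_power2)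

lemma tensor_norm_nonneg: "0 \<le> tensor_norm Bs T"
  by (simp add: tensor_norm_eq_L2_set)

lemma tensor_inner_self: "tensor_inner Bs T T = of_real ((tensor_norm Bs T)\<^sup>2)"
proof -
  have "tensor_inner Bs T T = of_real (\<Sum>is\<in>listset Bs. (cmod (T is))\<^sup>2)"
    by (simp add: tensor_inner_def complex_norm_square[symmetric])
  then show ?thesis
    by (simp add: tensor_norm_eq_L2_set L2_set_def sum_nonneg)
qed

lemma tensor_inner_commute: "tensor_inner Bs S T = cnj (tensor_inner Bs T S)"
  by (simp add: tensor_inner_def mult.commute)

lemma tensor_inner_diff_left:
  "tensor_inner Bs (\<lambda>is. S is - S' is) T = tensor_inner Bs S T - tensor_inner Bs S' T"
  by (simp add: tensor_inner_def algebra_simps sum_subtractf)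

lemma tensor_inner_diff_right:
  "tensor_inner Bs S (\<lambda>is. T is - T' is) = tensor_inner Bs S T - tensor_inner Bs S T'"
  by (simp add: tensor_inner_def algebra_simps sum_subtractf)

lemma tensor_inner_sum_left:
  "tensor_inner Bs (\<lambda>is. \<Sum>i\<in>I. c i * S i is) T = (\<Sum>i\<in>I. c i * tensor_inner Bs (S i) T)"
  unfolding tensor_inner_def sum_distrib_right sum_distrib_left
  by (subst sum.swap) (simp add: mult.assoc)

lemma tensor_inner_sum_list_left:
  "tensor_inner Bs (\<lambda>is. \<Sum>v\<leftarrow>vs. v is) T = (\<Sum>v\<leftarrow>vs. tensor_inner Bs v T)"
  by (induction vs) (simp_all add: tensor_inner_def algebra_simps sum.distrib)

lemma tensor_Cauchy_Schwarz:
  "cmod (tensor_inner Bs S T) \<le> tensor_norm Bs S * tensor_norm Bs T"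
proof -
  have "cmod (tensor_inner Bs S T) \<le> (\<Sum>is\<in>listset Bs. \<bar>cmod (S is)\<bar> * \<bar>cmod (T is)\<bar>)"
    unfolding tensor_inner_def by (rule order_trans[OF norm_sum]) (simp add: norm_mult)
  also have "\<dots> \<le> tensor_norm Bs S * tensor_norm Bs T"
    unfolding tensor_norm_eq_L2_set by (rule L2_set_mult_ineq)
  finally show ?thesis .
qed

text \<open>This is the equality case of Cauchy-Schwarz: the squared norm of \<open>S - T\<close>
  expands to \<open>1 - 1 - 1 + 1 = 0\<close>. Membership in \<open>tensor_space\<close> settles the
  indices outside \<open>listset Bs\<close>.\<close>

lemma unit_tensors_eqI:
  assumes fin: "finite (listset Bs)"
    and S: "S \<in> tensor_space Bs" "tensor_norm Bs S = 1"
    and T: "T \<in> tensor_space Bs" "tensor_norm Bs T = 1"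
    and "tensor_inner Bs S T = 1"
  shows "S = T"
proof -
  let ?D = "\<lambda>is. S is - T is"
  have "tensor_inner Bs T S = 1"
    using assms(6) tensor_inner_commute[of Bs T S] by simp
  then have "tensor_inner Bs ?D ?D = 0"
    using assms by (simp add: tensor_inner_diff_left tensor_inner_diff_right tensor_inner_self)
  then have "tensor_norm Bs ?D = 0"
    by (simp add: tensor_norm_def)
  then have "\<forall>is\<in>listset Bs. ?D is = 0"
    using fin by (simp add: tensor_norm_eq_L2_set L2_set_eq_0_iff)
  then show ?thesis
    using S(1) T(1) by (fastforce simp: tensor_space_def)
qed

section \<open>Index lists and inner products of pure tensors\<close>

lemma finite_listset: "(\<And>B. B \<in> set Bs \<Longrightarrow> finite B) \<Longrightarrow> finite (listset Bs)"
proof (induction Bs)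
  case (Cons B Bs)
  have "set_Cons B (listset Bs) = (\<lambda>(b, bs). b # bs) ` (B \<times> listset Bs)"
    by (auto simp: set_Cons_def)
  with Cons show ?case by simp
qed simp

lemma sum_listset_Cons:
  assumes "finite (listset Bs)" "finite B"
  shows "(\<Sum>is\<in>listset (B # Bs). f is) = (\<Sum>b\<in>B. \<Sum>is\<in>listset Bs. f (b # is))"
proof -
  have "listset (B # Bs) = (\<lambda>(b, is). b # is) ` (B \<times> listset Bs)"
    by (auto simp: set_Cons_def)
  moreover have "inj_on (\<lambda>(b, is). b # is) (B \<times> listset Bs)"
    by (auto simp: inj_on_def)
  ultimately show ?thesis
    using assms by (simp add: sum.reindex sum.cartesian_product case_prod_unfold)
qed

lemma listset3E:
  assumes "is \<in> listset [A, B, C]"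
  obtains a b c where "is = [a, b, c]" "a \<in> A" "b \<in> B" "c \<in> C"
  using assms by (auto simp: set_Cons_def)

lemma tensor_prod_in_tensor_space: "tensor_prod Bs vs \<in> tensor_space Bs"
  by (simp add: tensor_prod_def tensor_space_def)

lemma pure_tensors_subset: "pure_tensors Bs \<subseteq> tensor_space Bs"
  using tensor_prod_in_tensor_space by (auto simp: pure_tensors_def)

lemma tensor_prod_Cons:
  "b # is \<in> listset (B # Bs) \<Longrightarrow>
    tensor_prod (B # Bs) (v # vs) (b # is) = v b * tensor_prod Bs vs is"
  by (auto simp: tensor_prod_def set_Cons_def)

lemma tensor_inner_prod_Nil: "tensor_inner [] (tensor_prod [] []) (tensor_prod [] []) = 1"
  by (simp add: tensor_inner_def tensor_prod_def)

abbreviation inner_on :: "'b set \<Rightarrow> ('b \<Rightarrow> complex) \<Rightarrow> ('b \<Rightarrow> complex) \<Rightarrow> complex" where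
  "inner_on B u v \<equiv> \<Sum>b\<in>B. u b * cnj (v b)"

abbreviation norm_on :: "'b set \<Rightarrow> ('b \<Rightarrow> complex) \<Rightarrow> real" where
  "norm_on B v \<equiv> L2_set (\<lambda>b. cmod (v b)) B"

text \<open>Summing over the head and the tail of an index list separately splits off one factor, so
  inner products of pure tensors are products of inner products of their factors.\<close>

lemma tensor_inner_prod_Cons:
  assumes "finite (listset Bs)" "finite B"
  shows "tensor_inner (B # Bs) (tensor_prod (B # Bs) (u # us)) (tensor_prod (B # Bs) (v # vs)) =
    inner_on B u v * tensor_inner Bs (tensor_prod Bs us) (tensor_prod Bs vs)"
proof -
  have "tensor_inner (B # Bs) (tensor_prod (B # Bs) (u # us)) (tensor_prod (B # Bs) (v # vs)) =
    (\<Sum>b\<in>B. \<Sum>is\<in>listset Bs.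
      (u b * tensor_prod Bs us is) * cnj (v b * tensor_prod Bs vs is))"
    unfolding tensor_inner_def sum_listset_Cons[OF assms]
    by (intro sum.cong refl) (simp add: tensor_prod_Cons set_Cons_def)
  also have "\<dots> = inner_on B u v * tensor_inner Bs (tensor_prod Bs us) (tensor_prod Bs vs)"
    unfolding tensor_inner_def sum_product by (simp add: mult_ac)
  finally show ?thesis .
qed

lemma tensor_inner_prod3:
  assumes "finite B"
  shows "tensor_inner [B, B, B] (tensor_prod [B, B, B] [u1, u2, u3]) (tensor_prod [B, B, B] [v1, v2, v3])
    = inner_on B u1 v1 * inner_on B u2 v2 * inner_on B u3 v3"
proof -
  have fin: "finite (listset [])" "finite (listset [B])" "finite (listset [B, B])"
    by (rule finite_listset; use assms in simp)+
  show ?thesis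
    unfolding fin[THEN tensor_inner_prod_Cons, OF assms] tensor_inner_prod_Nil by simp
qed

lemma norm_on_power2: "of_real ((norm_on B v)\<^sup>2) = inner_on B v v"
  by (simp add: L2_set_def sum_nonneg complex_norm_square[symmetric])

lemma tensor_norm_prod3:
  assumes "finite B"
  shows "tensor_norm [B, B, B] (tensor_prod [B, B, B] [v1, v2, v3])
    = norm_on B v1 * norm_on B v2 * norm_on B v3" (is "?l = ?r")
proof -
  have "complex_of_real (?l\<^sup>2) = of_real (?r\<^sup>2)"
    unfolding tensor_inner_self[symmetric] tensor_inner_prod3[OF assms] power_mult_distrib of_real_mult
      norm_on_power2 ..
  then have "?l\<^sup>2 = ?r\<^sup>2"
    using of_real_eq_iff by blast
  then show ?thesis
    by (rule power2_eq_imp_eq) (simp_all add: tensor_norm_nonneg)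
qed

lemma pure_tensors3E:
  assumes "v \<in> pure_tensors [B, B, B]"
  obtains v1 v2 v3 where "v = tensor_prod [B, B, B] [v1, v2, v3]"
  using assms by (auto simp: pure_tensors_def length_Suc_conv numeral_3_eq_3)

section \<open>2-orthogonal tuples\<close>

text \<open>For \<open>t = 2\<close> the exponent \<open>2 / t\<close> is 1. It is kept as
  \<open>2 / 2\<close> so that the equation rewrites the unfolded \<open>t_orthogonal\<close>
  directly.\<close>

lemma bracket_exponent_2:
  "(\<Sum>S\<leftarrow>Ss. cmod (f S) powr (2 / 2)) powr (1 / (2 / 2)) = (\<Sum>S\<leftarrow>Ss. cmod (f S))"
proof -
  have "0 \<le> (\<Sum>S\<leftarrow>Ss. cmod (f S))"
    by (rule sum_list_nonneg) auto
  then show ?thesis by simp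
qed

lemma sum_list_tensor_inner_le:
  assumes ort: "t_orthogonal Bs 2 Ss"
    and u: "u \<in> pure_tensors Bs" "tensor_norm Bs u = 1"
  shows "(\<Sum>S\<leftarrow>Ss. cmod (tensor_inner Bs S u)) \<le> 1"
proof -
  let ?f = "\<lambda>u. \<Sum>S\<leftarrow>Ss. cmod (tensor_inner Bs S u)"
  let ?A = "{?f u | u. u \<in> pure_tensors Bs \<and> tensor_norm Bs u = 1}"
  \<comment> \<open>\<open>Sup\<close> on the reals bounds its elements only for sets that are
    bounded above; Cauchy-Schwarz on each term provides a crude bound.\<close>
  have "?f u \<le> length Ss" if "tensor_norm Bs u = 1" for u
  proof -
    have "?f u \<le> (\<Sum>S\<leftarrow>Ss. 1)"
    proof (rule sum_list_mono)
      fix S assume "S \<in> set Ss"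
      then show "cmod (tensor_inner Bs S u) \<le> 1"
        using ort that tensor_Cauchy_Schwarz[of Bs S u] by (simp add: t_orthogonal_def)
    qed
    then show ?thesis by (simp add: sum_list_triv)
  qed
  then have "bdd_above ?A"
    by (intro bdd_aboveI[where M = "real (length Ss)"]) auto
  then have "?f u \<le> Sup ?A"
    using u by (intro cSup_upper) auto
  also have "Sup ?A = 1"
    using ort unfolding t_orthogonal_def bracket_norm_def bracket_exponent_2 by simp
  finally show ?thesis .
qed

text \<open>Tested on \<open>v\<close>, the entry \<open>v\<close> itself already contributes 1 to a
  sum that is at most 1, so all other terms vanish. Splitting by position allows \<open>w\<close> to
  be a second copy of \<open>v\<close>, which is how repetitions are excluded later.\<close>

lemma two_orthogonal_split:
  assumes ort: "t_orthogonal Bs 2 (xs @ v # ys)" and v: "v \<in> pure_tensors Bs"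
    and w: "w \<in> set (xs @ ys)"
  shows "tensor_inner Bs w v = 0"
proof -
  have nv: "tensor_norm Bs v = 1"
    using ort by (simp add: t_orthogonal_def)
  have "(\<Sum>S\<leftarrow>xs @ ys. cmod (tensor_inner Bs S v)) \<le> 0"
    using sum_list_tensor_inner_le[OF ort v nv] by (simp add: tensor_inner_self nv)
  moreover have "cmod (tensor_inner Bs w v) \<le> (\<Sum>S\<leftarrow>xs @ ys. cmod (tensor_inner Bs S v))"
    using w by (intro member_le_sum_list) auto
  ultimately show ?thesis
    by (metis norm_le_zero_iff order_trans)
qed

lemma two_orthogonal_inner:
  assumes ort: "t_orthogonal Bs 2 Ss" and pure: "set Ss \<subseteq> pure_tensors Bs"
    and "v \<in> set Ss" "w \<in> set Ss" "v \<noteq> w"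
  shows "tensor_inner Bs v w = 0"
proof -
  obtain xs ys where "Ss = xs @ w # ys"
    using \<open>w \<in> set Ss\<close> by (meson split_list)
  then show ?thesis
    using two_orthogonal_split[of Bs xs w ys v] assms by auto
qed

lemma two_orthogonal_distinct:
  assumes ort: "t_orthogonal Bs 2 Ss" and pure: "set Ss \<subseteq> pure_tensors Bs"
  shows "distinct Ss"
proof (rule ccontr)
  assume "\<not> distinct Ss"
  then obtain xs ys zs v where Ss: "Ss = xs @ [v] @ ys @ [v] @ zs"
    using not_distinct_decomp by blast
  then have "tensor_inner Bs v v = 0"
    using two_orthogonal_split[of Bs xs v "ys @ v # zs" v] assms by auto
  moreover have "tensor_norm Bs v = 1"
    using ort Ss by (simp add: t_orthogonal_def)
  ultimately show False
    by (simp add: tensor_inner_self)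
qed

section \<open>Sums of cubes of orthonormal vectors\<close>

text \<open>The vector \<open>p\<close> is the orthogonal projection of \<open>v\<close> onto the
  span of the \<open>e t\<close>. By Pythagoras its squared norm, the sum of the squared
  coefficients, is at most that of \<open>v\<close>.\<close>

lemma bessel:
  fixes e :: "nat \<Rightarrow> 'b \<Rightarrow> complex"
  assumes ort: "\<And>s t. s < n \<Longrightarrow> t < n \<Longrightarrow> inner_on B (e s) (e t) = (if s = t then 1 else 0)"
  shows "L2_set (\<lambda>t. cmod (inner_on B (e t) v)) {..<n} \<le> norm_on B v"
proof -
  define c where "c t = inner_on B v (e t)" for t
  define p where "p b = (\<Sum>t<n. c t * e t b)" for b
  have cnj_c: "inner_on B (e t) v = cnj (c t)" for t
    by (simp add: c_def mult.commute)
  have pe: "inner_on B p (e t) = c t" if "t < n" for t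
  proof -
    have "inner_on B p (e t) = (\<Sum>s<n. c s * inner_on B (e s) (e t))"
      unfolding p_def sum_distrib_right sum_distrib_left
      by (subst sum.swap) (simp add: mult.assoc)
    also have "\<dots> = c t"
      using that by (simp add: ort if_distrib cong: if_cong)
    finally show ?thesis .
  qed
  have xp: "inner_on B w p = (\<Sum>t<n. cnj (c t) * inner_on B w (e t))" for w
    unfolding p_def cnj_sum sum_distrib_left
    by (subst sum.swap) (simp add: mult_ac)
  have ort_p: "inner_on B (\<lambda>b. v b - p b) p = 0"
    unfolding xp by (simp add: left_diff_distrib sum_subtractf pe c_def[symmetric])
  have "inner_on B p (\<lambda>b. v b - p b) = cnj (inner_on B (\<lambda>b. v b - p b) p)"
    by (simp add: mult.commute)
  then have "inner_on B p (\<lambda>b. v b - p b) = 0"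
    unfolding ort_p by simp
  then have "inner_on B v v = inner_on B (\<lambda>b. v b - p b) (\<lambda>b. v b - p b) + inner_on B p p"
    using ort_p by (simp add: algebra_simps sum.distrib sum_subtractf)
  also have "inner_on B p p = (\<Sum>t<n. cnj (c t) * c t)"
    unfolding xp by (simp add: pe)
  also have "\<dots> = of_real (\<Sum>t<n. (cmod (c t))\<^sup>2)"
    by (simp add: complex_norm_square[symmetric] mult.commute)
  finally have "(norm_on B v)\<^sup>2 = (norm_on B (\<lambda>b. v b - p b))\<^sup>2 + (\<Sum>t<n. (cmod (c t))\<^sup>2)"
    unfolding norm_on_power2[symmetric] by (metis of_real_add of_real_eq_iff)
  then have "(\<Sum>t<n. (cmod (c t))\<^sup>2) \<le> (norm_on B v)\<^sup>2"
    by simp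
  then show ?thesis
    unfolding cnj_c L2_set_def[of _ "{..<n}"] by (simp add: real_le_lsqrt)
qed

text \<open>Cauchy-Schwarz is spent on \<open>p\<close> and \<open>q\<close> only; the third factor
  needs just a pointwise bound. This asymmetry is what leaves room to analyse equality.\<close>

lemma sum_mult3_le_L2:
  fixes p q r :: "'i \<Rightarrow> real"
  assumes "finite I" "\<And>i. i \<in> I \<Longrightarrow> 0 \<le> p i" "\<And>i. i \<in> I \<Longrightarrow> 0 \<le> q i"
    and "\<And>i. i \<in> I \<Longrightarrow> r i \<le> M" "0 \<le> M"
    and "L2_set p I \<le> a" "L2_set q I \<le> b"
  shows "(\<Sum>i\<in>I. p i * q i * r i) \<le> a * b * M"
proof -
  have "(\<Sum>i\<in>I. p i * q i * r i) \<le> (\<Sum>i\<in>I. p i * q i * M)"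
    using assms by (intro sum_mono mult_left_mono) auto
  also have "\<dots> = (\<Sum>i\<in>I. \<bar>p i\<bar> * \<bar>q i\<bar>) * M"
    using assms by (simp add: sum_distrib_right)
  also have "\<dots> \<le> (L2_set p I * L2_set q I) * M"
    using assms by (intro mult_right_mono L2_set_mult_ineq)
  also have "\<dots> \<le> a * b * M"
    using assms by (intro mult_right_mono mult_mono) (auto intro: order_trans[OF L2_set_nonneg])
  finally show ?thesis .
qed

text \<open>
  A family \<open>r\<close> of norm at most \<open>c\<close> with an entry as large as \<open>c\<close> is supported at that entry, so
  equality in the previous estimate forces a single nonzero term.
\<close>

lemma sum_mult3_eq_L2:
  fixes p q r :: "'i \<Rightarrow> real"
  assumes fin: "finite I" and nonneg: "\<And>i. i \<in> I \<Longrightarrow> 0 \<le> p i" "\<And>i. i \<in> I \<Longrightarrow> 0 \<le> q i" "\<And>i. i \<in> I \<Longrightarrow> 0 \<le> r i"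
    and le: "L2_set p I \<le> a" "L2_set q I \<le> b" "L2_set r I \<le> c"
    and pos: "0 < a * b * c"
    and ge: "a * b * c \<le> (\<Sum>i\<in>I. p i * q i * r i)"
  obtains k where "k \<in> I" "\<And>i. i \<in> I \<Longrightarrow> i \<noteq> k \<Longrightarrow> r i = 0"
proof -
  have "I \<noteq> {}"
    using pos ge by auto
  then obtain k where k: "k \<in> I" "\<And>i. i \<in> I \<Longrightarrow> r i \<le> r k"
    using fin obtains_MAX by (metis Max_ge finite_imageI imageI)
  have "0 \<le> a" "0 \<le> b" "0 \<le> c"
    using le by (auto intro: order_trans[OF L2_set_nonneg])
  then have "0 < a * b"
    using pos by (metis mult_nonneg_nonneg mult_zero_left order_less_le)
  \<comment> \<open>The previous estimate is applied with \<open>M = r k\<close>, the largest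
    entry.\<close>
  have "a * b * c \<le> a * b * r k"
    using ge sum_mult3_le_L2[OF fin nonneg(1,2) k(2) nonneg(3) le(1,2)] k(1) by force
  then have "c \<le> r k"
    using \<open>0 < a * b\<close> mult_le_cancel_left_pos by blast
  have "r i = 0" if "i \<in> I" "i \<noteq> k" for i
  proof -
    have "(\<Sum>i\<in>I. (r i)\<^sup>2) \<le> c\<^sup>2"
      using le(3) \<open>0 \<le> c\<close> by (simp add: L2_set_def sqrt_le_D)
    also have "\<dots> \<le> (r k)\<^sup>2"
      using \<open>c \<le> r k\<close> \<open>0 \<le> c\<close> by (simp add: power_mono)
    finally have "(\<Sum>i\<in>I - {k}. (r i)\<^sup>2) \<le> 0"
      using fin k(1) by (simp add: sum.remove[of I k])
    moreover have "(r i)\<^sup>2 \<le> (\<Sum>i\<in>I - {k}. (r i)\<^sup>2)"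
      using fin that by (intro member_le_sum) auto
    ultimately show ?thesis
      by (metis order_trans power2_less_eq_zero_iff)
  qed
  with k(1) show thesis by (rule that)
qed

text \<open>The argument works for any finite orthonormal family and any common weight
  \<open>s > 0\<close>; the group enters only when the Fourier vectors are shown to be an
  instance.\<close>

locale orthonormal_cubes =
  fixes B :: "'b set" and e :: "nat \<Rightarrow> 'b \<Rightarrow> complex" and n :: nat and s :: real
  assumes finite_B: "finite B"
    and orthonormal: "\<And>i j. i < n \<Longrightarrow> j < n \<Longrightarrow> inner_on B (e i) (e j) = (if i = j then 1 else 0)"
    and n_pos: "0 < n" and s_pos: "0 < s"
begin

abbreviation Bs :: "'b set list" where "Bs \<equiv> [B, B, B]"

definition cube :: "nat \<Rightarrow> 'b tensor" where
  "cube t = tensor_prod Bs [e t, e t, e t]"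

definition cube_sum :: "'b tensor" where
  "cube_sum = (\<lambda>is. \<Sum>t<n. of_real s * cube t is)"

definition cube_decomposition :: "(real \<times> 'b tensor) list" where
  "cube_decomposition = map (\<lambda>t. (s, cube t)) [0..<n]"

section \<open>Pairing pure tensors with the cubes\<close>

lemma finite_Bs: "finite (listset Bs)"
  using finite_B by (intro finite_listset) auto

lemma norm_e: "t < n \<Longrightarrow> norm_on B (e t) = 1"
proof -
  assume "t < n"
  then have "complex_of_real ((norm_on B (e t))\<^sup>2) = of_real 1"
    unfolding norm_on_power2 by (simp add: orthonormal)
  then have "(norm_on B (e t))\<^sup>2 = 1"
    using of_real_eq_iff by blast
  then show ?thesis
    by (simp add: power2_eq_1_iff) (use L2_set_nonneg[of "\<lambda>b. cmod (e t b)" B] in linarith)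
qed

lemma cube_pure: "cube t \<in> pure_tensors Bs"
  unfolding cube_def pure_tensors_def by force

lemma inner_cube:
  "i < n \<Longrightarrow> j < n \<Longrightarrow> tensor_inner Bs (cube i) (cube j) = (if i = j then 1 else 0)"
  by (simp add: cube_def tensor_inner_prod3[OF finite_B] orthonormal)

lemma norm_cube: "t < n \<Longrightarrow> tensor_norm Bs (cube t) = 1"
  by (simp add: cube_def tensor_norm_prod3[OF finite_B] norm_e)

lemma cube_inj: "i < n \<Longrightarrow> j < n \<Longrightarrow> cube i = cube j \<longleftrightarrow> i = j"
  using inner_cube[of i j] inner_cube[of i i] by (auto split: if_splits)

text \<open>Each term is a product of three coefficients of the factors of \<open>v\<close>. Bessel
  bounds the coefficients of each factor in L2 norm, hence those of the third one also
  entrywise.\<close>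

lemma sum_inner_cube_le:
  assumes "v \<in> pure_tensors Bs"
  shows "(\<Sum>t<n. cmod (tensor_inner Bs (cube t) v)) \<le> tensor_norm Bs v"
proof -
  obtain v1 v2 v3 where v: "v = tensor_prod Bs [v1, v2, v3]"
    using assms by (rule pure_tensors3E)
  have "cmod (inner_on B (e t) v3) \<le> norm_on B v3" if "t < n" for t
    using that member_le_L2_set[of "{..<n}" t "\<lambda>t. cmod (inner_on B (e t) v3)"]
      bessel[where n = n and v = v3, OF orthonormal] by simp
  then show ?thesis
    unfolding v cube_def tensor_inner_prod3[OF finite_B] tensor_norm_prod3[OF finite_B] norm_mult
    by (intro sum_mult3_le_L2 bessel orthonormal) auto
qed

text \<open>The triangle inequality forces equality in the preceding bound, so the coefficients of
  \<open>v3\<close> live at a single index \<open>k\<close>. Then \<open>cube k\<close> has inner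
  product 1 with \<open>v\<close>, and two such unit tensors coincide.\<close>

lemma sum_inner_cube_eq_1:
  assumes "v \<in> pure_tensors Bs" "tensor_norm Bs v = 1"
    and sum1: "(\<Sum>t<n. tensor_inner Bs (cube t) v) = 1"
  obtains t where "t < n" "v = cube t"
proof -
  obtain v1 v2 v3 where v: "v = tensor_prod Bs [v1, v2, v3]"
    using assms(1) by (rule pure_tensors3E)
  let ?p = "\<lambda>w t. cmod (inner_on B (e t) w)"
  have one: "norm_on B v1 * norm_on B v2 * norm_on B v3 = 1"
    using assms(2) by (simp add: v tensor_norm_prod3[OF finite_B])
  have "1 \<le> (\<Sum>t<n. cmod (tensor_inner Bs (cube t) v))"
    using norm_sum[of "\<lambda>t. tensor_inner Bs (cube t) v" "{..<n}"] sum1 by simp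
  then have ge: "norm_on B v1 * norm_on B v2 * norm_on B v3 \<le> (\<Sum>t<n. ?p v1 t * ?p v2 t * ?p v3 t)"
    unfolding one by (simp add: v cube_def tensor_inner_prod3[OF finite_B] norm_mult)
  obtain k where k: "k < n" "\<And>t. t < n \<Longrightarrow> t \<noteq> k \<Longrightarrow> ?p v3 t = 0"
    by (rule sum_mult3_eq_L2[OF _ _ _ _ bessel bessel bessel _ ge])
      (auto simp: one orthonormal)
  have "tensor_inner Bs (cube t) v = 0" if "t < n" "t \<noteq> k" for t
    using k(2)[OF that] by (simp add: v cube_def tensor_inner_prod3[OF finite_B])
  then have "(\<Sum>t<n. tensor_inner Bs (cube t) v) = (\<Sum>t<n. if t = k then tensor_inner Bs (cube k) v else 0)"
    by (intro sum.cong) auto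
  then have "tensor_inner Bs (cube k) v = 1"
    using sum1 k(1) by simp
  then have "cube k = v"
    using assms pure_tensors_subset[of Bs] cube_pure norm_cube[OF k(1)]
    by (intro unit_tensors_eqI[OF finite_Bs]) auto
  with k(1) show thesis using that by blast
qed

lemma inner_cube_sum: "tensor_inner Bs cube_sum v = s * (\<Sum>t<n. tensor_inner Bs (cube t) v)"
  unfolding cube_sum_def by (simp add: tensor_inner_sum_left sum_distrib_left)

lemma inner_cube_sum_cube: "t < n \<Longrightarrow> tensor_inner Bs cube_sum (cube t) = s"
  by (simp add: inner_cube_sum inner_cube)

lemma two_orthogonal_cubes: "t_orthogonal Bs 2 (map cube [0..<n])"
proof -
  have sum_map: "(\<Sum>S\<leftarrow>map cube [0..<n]. cmod (tensor_inner Bs S u)) =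
      (\<Sum>t<n. cmod (tensor_inner Bs (cube t) u))" for u
    by (simp add: o_def interv_sum_list_conv_sum_set_nat lessThan_atLeast0)
  have "bracket_norm Bs (2 / 2) (map cube [0..<n]) = 1"
    unfolding bracket_norm_def bracket_exponent_2 sum_map
  proof (rule cSup_eq_maximum)
    \<comment> \<open>The maximum 1 is attained at \<open>cube 0\<close>, which is a unit tensor
      because \<open>0 < n\<close>.\<close>
    have "(\<Sum>t<n. cmod (tensor_inner Bs (cube t) (cube 0))) = (\<Sum>t<n. if t = 0 then 1 else 0)"
      using n_pos by (intro sum.cong) (auto simp: inner_cube)
    also have "\<dots> = 1"
      using n_pos by simp
    finally show "1 \<in> {\<Sum>t<n. cmod (tensor_inner Bs (cube t) u) |u.
        u \<in> pure_tensors Bs \<and> tensor_norm Bs u = 1}"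
      by (intro CollectI exI[of _ "cube 0"] conjI) (auto simp: cube_pure norm_cube n_pos)
  qed (use sum_inner_cube_le in force)
  then show ?thesis
    using cube_pure pure_tensors_subset[of Bs] norm_cube by (auto simp: t_orthogonal_def)
qed

section \<open>Existence and uniqueness of the diagonal singular value decomposition\<close>

lemma cube_decomposition_svd: "diagonal_svd Bs cube_sum cube_decomposition"
proof -
  have "map snd cube_decomposition = map cube [0..<n]" "map fst cube_decomposition = replicate n s"
    by (simp_all add: cube_decomposition_def o_def map_replicate_const)
  moreover have "sorted_wrt (\<ge>) (replicate n s)"
    by (simp add: sorted_wrt_iff_nth_less)
  moreover have "cube_sum = (\<lambda>is. \<Sum>(\<sigma>, v)\<leftarrow>cube_decomposition. of_real \<sigma> * v is)"
    by (simp add: cube_sum_def cube_decomposition_def o_def interv_sum_list_conv_sum_set_nat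
        lessThan_atLeast0)
  moreover have "set (map cube [0..<n]) \<subseteq> pure_tensors Bs"
    using cube_pure by auto
  ultimately show ?thesis
    using two_orthogonal_cubes s_pos unfolding diagonal_svd_def by (metis in_set_replicate)
qed

lemma diagonal_svd_cube_sum_unique:
  assumes "diagonal_svd Bs cube_sum D"
  shows "mset D = mset cube_decomposition"
proof -
  have sum_D: "cube_sum = (\<lambda>is. \<Sum>(\<sigma>, v)\<leftarrow>D. of_real \<sigma> * v is)"
    and pos: "\<And>\<sigma> v. (\<sigma>, v) \<in> set D \<Longrightarrow> 0 < \<sigma>"
    and pure: "set (map snd D) \<subseteq> pure_tensors Bs"
    and ort: "t_orthogonal Bs 2 (map snd D)"
    using assms by (force simp: diagonal_svd_def)+
  have pure': "v \<in> pure_tensors Bs" and unit: "tensor_norm Bs v = 1" if "(\<sigma>, v) \<in> set D" for \<sigma> v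
    using that pure ort by (force simp: t_orthogonal_def)+
  have dist_snd: "distinct (map snd D)"
    by (rule two_orthogonal_distinct[OF ort pure])
  \<comment> \<open>Distinctness turns sums over the list \<open>D\<close> into sums over
    \<open>set D\<close>, and finally reduces equality of multisets to equality of sets.\<close>
  then have dist: "distinct D"
    by (simp add: distinct_map)
  have inner_D: "tensor_inner Bs v w = 0" if "(\<sigma>, v) \<in> set D" "(\<tau>, w) \<in> set D" "v \<noteq> w" for \<sigma> \<tau> v w
    using that by (intro two_orthogonal_inner[OF ort pure]) force+
  have inner_sum_D: "tensor_inner Bs cube_sum u = (\<Sum>x\<in>set D. of_real (fst x) * tensor_inner Bs (snd x) u)" for u
    unfolding sum_D using dist
    by (simp add: sum_list_distinct_conv_sum_set case_prod_unfold
        tensor_inner_sum_left[where c = "\<lambda>x. of_real (fst x)"])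
  have coeff: "tensor_inner Bs cube_sum v = of_real \<sigma>" if D: "(\<sigma>, v) \<in> set D" for \<sigma> v
  proof -
    have "of_real (fst x) * tensor_inner Bs (snd x) v = (if x = (\<sigma>, v) then of_real \<sigma> else 0)"
      if x: "x \<in> set D" for x
    proof (cases "snd x = v")
      case True
      then have "x = (\<sigma>, v)"
        using D x dist_snd by (metis distinct_map inj_onD snd_conv)
      then show ?thesis
        using unit[OF D] by (simp add: tensor_inner_self)
    next
      case False
      then show ?thesis
        using inner_D[of "fst x" "snd x" \<sigma> v] D x by auto
    qed
    then have "tensor_inner Bs cube_sum v = (\<Sum>x\<in>set D. if x = (\<sigma>, v) then of_real \<sigma> else 0)"
      unfolding inner_sum_D by (intro sum.cong) auto
    then show ?thesis
      using D by simp
  qed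
  have le_s: "\<sigma> \<le> s" if D: "(\<sigma>, v) \<in> set D" for \<sigma> v
  proof -
    have "\<sigma> = cmod (tensor_inner Bs cube_sum v)"
      using coeff[OF D] pos[OF D] by simp
    also have "\<dots> = s * cmod (\<Sum>t<n. tensor_inner Bs (cube t) v)"
      using s_pos by (simp add: inner_cube_sum norm_mult)
    also have "\<dots> \<le> s * (\<Sum>t<n. cmod (tensor_inner Bs (cube t) v))"
      using s_pos by (intro mult_left_mono norm_sum) auto
    also have "\<dots> \<le> s * 1"
      using s_pos sum_inner_cube_le[OF pure'[OF D]] unit[OF D] by (intro mult_left_mono) auto
    finally show ?thesis by simp
  qed
  have eq_s: "\<exists>t<n. v = cube t" if D: "(s, v) \<in> set D" for v
  proof -
    have "(\<Sum>t<n. tensor_inner Bs (cube t) v) = 1"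
      using coeff[OF D] s_pos by (simp add: inner_cube_sum)
    then show ?thesis
      using sum_inner_cube_eq_1[OF pure'[OF D] unit[OF D]] by blast
  qed
  have cube_in: "\<exists>\<sigma>. (\<sigma>, cube t) \<in> set D" if t: "t < n" for t
  proof -
    let ?c = "\<lambda>x. cmod (tensor_inner Bs (snd x) (cube t))"
    have "s = cmod (tensor_inner Bs cube_sum (cube t))"
      using inner_cube_sum_cube[OF t] s_pos by simp
    also have "\<dots> \<le> (\<Sum>x\<in>set D. cmod (of_real (fst x) * tensor_inner Bs (snd x) (cube t)))"
      unfolding inner_sum_D by (rule norm_sum)
    also have "\<dots> = (\<Sum>x\<in>set D. fst x * ?c x)"
      using pos by (intro sum.cong refl) (auto simp: norm_mult abs_of_pos)
    finally have lower: "s \<le> (\<Sum>x\<in>set D. fst x * ?c x)" .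
    have "(\<Sum>x\<in>set D. ?c x) \<le> 1"
      using sum_list_tensor_inner_le[OF ort cube_pure norm_cube[OF t]] dist
      by (simp add: sum_list_distinct_conv_sum_set o_def)
    then have "(\<Sum>x\<in>set D. s * ?c x) \<le> s"
      using s_pos by (simp flip: sum_distrib_left)
    \<comment> \<open>Since no weight exceeds \<open>s\<close>, the terms are nonnegative and hence
      all zero: only entries of weight \<open>s\<close> can meet \<open>cube t\<close>.\<close>
    with lower have "(\<Sum>x\<in>set D. (s - fst x) * ?c x) \<le> 0"
      by (simp add: left_diff_distrib sum_subtractf)
    moreover have nonneg: "0 \<le> (s - fst x) * ?c x" if "x \<in> set D" for x
      using le_s[of "fst x" "snd x"] that by simp
    ultimately have zero: "(s - fst x) * ?c x = 0" if "x \<in> set D" for x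
      using that sum_nonneg_eq_0_iff[of "set D" "\<lambda>x. (s - fst x) * ?c x"]
        sum_nonneg[of "set D" "\<lambda>x. (s - fst x) * ?c x"] by fastforce
    \<comment> \<open>If all these terms vanished, \<open>lower\<close> would give
      \<open>s \<le> 0\<close>. The entry found has weight \<open>s\<close>, so it is some cube, and
      it is \<open>cube t\<close> because it is not orthogonal to it.\<close>
    obtain x where x: "x \<in> set D" "fst x * ?c x \<noteq> 0"
      using lower s_pos by (metis (no_types, lifting) not_le sum.neutral)
    then have "x = (s, snd x)"
      using zero[OF x(1)] by (cases x) auto
    then obtain k where "k < n" "snd x = cube k"
      using eq_s x(1) by metis
    moreover have "k = t"
      using x(2) inner_cube[of k t] t calculation by (auto split: if_splits)
    ultimately show ?thesis
      using x(1) by (metis prod.collapse)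
  qed
  have "(\<sigma>, v) \<in> (\<lambda>t. (s, cube t)) ` {..<n}" if D: "(\<sigma>, v) \<in> set D" for \<sigma> v
  proof (cases "\<exists>t<n. v = cube t")
    case True
    then show ?thesis
      using coeff[OF D] inner_cube_sum_cube by auto
  next
    case False
    \<comment> \<open>Every cube occurs in \<open>D\<close>, and distinct tensors in
      \<open>D\<close> are orthogonal.\<close>
    then have "tensor_inner Bs (cube t) v = 0" if "t < n" for t
      using cube_in[OF that] inner_D D that by metis
    then have "complex_of_real \<sigma> = 0"
      using coeff[OF D] by (simp add: inner_cube_sum)
    then show ?thesis
      using pos[OF D] by simp
  qed
  moreover have "(s, cube t) \<in> set D" if "t < n" for t
    using cube_in[OF that] coeff inner_cube_sum_cube[OF that] by (metis of_real_eq_iff)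
  ultimately have "set D = set cube_decomposition"
    by (auto simp: cube_decomposition_def lessThan_atLeast0)
  moreover have "distinct cube_decomposition"
    by (auto simp: cube_decomposition_def distinct_map inj_on_def cube_inj)
  ultimately show ?thesis
    using dist by (simp add: set_eq_iff_mset_eq_distinct)
qed

text \<open>All weights are equal, so knowing the decomposition up to order already determines the
  list of weights.\<close>

lemma singular_values_cube_sum: "singular_values Bs cube_sum = replicate n s"
  unfolding singular_values_def
proof (rule the_equality)
  have "map fst cube_decomposition = replicate n s"
    by (simp add: cube_decomposition_def o_def map_replicate_const)
  then show "\<exists>D. diagonal_svd Bs cube_sum D \<and> replicate n s = map fst D"
    using cube_decomposition_svd by metis
next
  fix \<sigma>s assume "\<exists>D. diagonal_svd Bs cube_sum D \<and> \<sigma>s = map fst D"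
  then obtain D where D: "mset D = mset cube_decomposition" "\<sigma>s = map fst D"
    using diagonal_svd_cube_sum_unique by blast
  then have "length \<sigma>s = n" "set \<sigma>s \<subseteq> {s}"
    using mset_eq_length[OF D(1)] mset_eq_setD[OF D(1)] by (auto simp: cube_decomposition_def)
  then show "\<sigma>s = replicate n s"
    by (intro replicate_eqI) auto
qed

text \<open>The cubes give the upper bound. For the lower bound, any decomposition is paired with
  the sum of the cubes: the total is \<open>n * s\<close>, and each pure summand contributes at most
  its norm.\<close>

lemma nuclear_norm_cube_sum: "nuclear_norm Bs cube_sum = n * s"
  unfolding nuclear_norm_def
proof (rule cInf_eq_minimum)
  \<comment> \<open>The weight \<open>s\<close> is absorbed into the first factor, so that each
    summand is a pure tensor.\<close>
  define vs where "vs = map (\<lambda>t. tensor_prod Bs [\<lambda>b. of_real s * e t b, e t, e t]) [0..<n]"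
  have scaled: "tensor_prod Bs [\<lambda>b. of_real s * e t b, e t, e t] = (\<lambda>is. of_real s * cube t is)" for t
  proof
    fix "is"
    show "tensor_prod Bs [\<lambda>b. of_real s * e t b, e t, e t] is = of_real s * cube t is"
    proof (cases "is \<in> listset Bs")
      case True
      then show ?thesis
        by (rule listset3E) (use True in \<open>simp add: cube_def tensor_prod_def del: listset.simps\<close>)
    qed (simp add: cube_def tensor_prod_def del: listset.simps)
  qed
  have "tensor_norm Bs (tensor_prod Bs [\<lambda>b. of_real s * e t b, e t, e t]) = s" if "t < n" for t
    using that s_pos L2_set_right_distrib[of s "\<lambda>b. cmod (e t b)" B]
    by (simp add: tensor_norm_prod3[OF finite_B] norm_e norm_mult)
  then have "(\<Sum>v\<leftarrow>vs. tensor_norm Bs v) = n * s"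
    by (simp add: vs_def o_def interv_sum_list_conv_sum_set_nat)
  moreover have "set vs \<subseteq> pure_tensors Bs"
    by (force simp: vs_def pure_tensors_def)
  moreover have "cube_sum = (\<lambda>is. \<Sum>v\<leftarrow>vs. v is)"
    by (simp add: cube_sum_def vs_def scaled o_def interv_sum_list_conv_sum_set_nat
        lessThan_atLeast0)
  ultimately show "n * s \<in> {\<Sum>v\<leftarrow>vs. tensor_norm Bs v |vs.
      set vs \<subseteq> pure_tensors Bs \<and> cube_sum = (\<lambda>is. \<Sum>v\<leftarrow>vs. v is)}"
    by (intro CollectI exI[of _ vs] conjI) auto
next
  fix x assume "x \<in> {\<Sum>v\<leftarrow>vs. tensor_norm Bs v |vs.
      set vs \<subseteq> pure_tensors Bs \<and> cube_sum = (\<lambda>is. \<Sum>v\<leftarrow>vs. v is)}"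
  then obtain vs where x: "x = (\<Sum>v\<leftarrow>vs. tensor_norm Bs v)"
    and pure: "set vs \<subseteq> pure_tensors Bs" and sum_vs: "cube_sum = (\<lambda>is. \<Sum>v\<leftarrow>vs. v is)"
    by blast
  have "(\<Sum>t<n. tensor_inner Bs cube_sum (cube t)) = of_real (n * s)"
    by (simp add: inner_cube_sum_cube)
  then have "n * s = cmod (\<Sum>t<n. tensor_inner Bs cube_sum (cube t))"
    using s_pos by (simp only: norm_of_real) simp
  also have "\<dots> = cmod (\<Sum>v\<leftarrow>vs. \<Sum>t<n. tensor_inner Bs v (cube t))"
    unfolding sum_vs tensor_inner_sum_list_left
    by (rule arg_cong[where f = cmod], induction vs) (simp_all add: sum.distrib)
  also have "\<dots> \<le> (\<Sum>v\<leftarrow>vs. tensor_norm Bs v)"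
    using pure
  proof (induction vs)
    case (Cons v vs)
    have "cmod (\<Sum>t<n. tensor_inner Bs v (cube t)) \<le> (\<Sum>t<n. cmod (tensor_inner Bs (cube t) v))"
      by (rule order_trans[OF norm_sum]) (simp add: tensor_inner_commute[of _ v])
    also have "\<dots> \<le> tensor_norm Bs v"
      using Cons.prems by (intro sum_inner_cube_le) auto
    finally show ?case
      using Cons by (simp add: norm_triangle_le)
  qed simp
  finally show "n * s \<le> x" by (simp add: x)
qed

end

section \<open>The Fourier basis\<close>

lemma root_of_unity_power: "root_of_unity n ^ k = cis (2 * pi * real k / real n)"
proof -
  have "root_of_unity n = cis (2 * pi / real n)"
    by (simp add: root_of_unity_def cis_conv_exp mult_ac)
  then show ?thesis
    by (simp add: DeMoivre mult_ac)
qed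

lemma root_of_unity_power_n: "0 < n \<Longrightarrow> root_of_unity n ^ n = 1"
  by (simp add: root_of_unity_power)

lemma root_of_unity_inj:
  assumes "i < n" "j < n" "root_of_unity n ^ i = root_of_unity n ^ j"
  shows "i = j"
proof -
  have "inj_on (\<lambda>k. cis (2 * pi * real k / real n)) {..<n}"
    using bij_betw_roots_unity[of n] assms(1) by (auto simp: bij_betw_def)
  then show ?thesis
    using assms by (auto simp: root_of_unity_power dest: inj_onD)
qed

lemma sum_powers_root_of_unity:
  fixes z :: complex
  assumes "z ^ n = 1"
  shows "(\<Sum>k<n. z ^ k) = (if z = 1 then of_nat n else 0)"
  using assms by (simp add: geometric_sum)

lemma root_of_unity_power_eq_1:
  assumes "0 < n"
  shows "root_of_unity n ^ m = 1 \<longleftrightarrow> m mod n = 0"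
proof -
  have "root_of_unity n ^ m = root_of_unity n ^ (n * (m div n) + m mod n)"
    by simp
  also have "\<dots> = root_of_unity n ^ (m mod n)"
    unfolding power_add power_mult root_of_unity_power_n[OF assms] by simp
  finally show ?thesis
    using assms root_of_unity_inj[of "m mod n" n 0] by auto
qed

section \<open>Fourier vectors on a cyclic group\<close>

locale generated_cyclic_group = group G for G :: "('a, 'b) monoid_scheme" (structure) +
  fixes x :: 'a and n :: nat
  assumes n_pos: "0 < n" and order: "order G = n"
    and x_in: "x \<in> carrier G" and gen: "generate G {x} = carrier G"
begin

lemma finite_carrier: "finite (carrier G)"
  \<comment> \<open>An infinite carrier would have \<open>card\<close> equal to 0, so positive order
    means finite.\<close>
  using n_pos order card_gt_0_iff by (auto simp: order_def)

text \<open>The order of \<open>x\<close> is the size of the subgroup it generates, which gives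
  injectivity; surjectivity follows by counting.\<close>

lemma bij_powers: "bij_betw (\<lambda>a. x [^] a) {..<n} (carrier G)"
proof -
  have "ord x = n"
    using generate_pow_card[OF x_in] order gen by (simp add: order_def)
  moreover have "{0..n - 1} = {..<n}"
    using n_pos by auto
  ultimately have inj: "inj_on (\<lambda>a. x [^] a) {..<n}"
    using ord_inj[OF x_in] by simp
  moreover have "(\<lambda>a. x [^] a) ` {..<n} = carrier G"
    using finite_carrier x_in order by (intro card_subset_eq) (auto simp: card_image[OF inj] order_def)
  ultimately show ?thesis
    by (simp add: bij_betw_def)
qed

lemma powers_eq_iff: "a < n \<Longrightarrow> b < n \<Longrightarrow> x [^] a = x [^] b \<longleftrightarrow> a = b"
  using bij_powers by (auto simp: bij_betw_def dest: inj_onD)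

lemma fourier_vec_power:
  "a < n \<Longrightarrow> fourier_vec G x n t (x [^] a) = root_of_unity n ^ (t * a) / of_real (sqrt n)"
  by (simp add: fourier_vec_def basis_vec_def powers_eq_iff if_distrib cong: if_cong)

text \<open>Indexing the group by powers of \<open>x\<close> makes the inner product the average of
  the powers of \<open>?z\<close>, that is, of zeta to the power \<open>s - t\<close>. It is an n-th
  root of unity, equal to 1 only if \<open>s = t\<close>.\<close>

lemma fourier_orthonormal:
  assumes "s < n" "t < n"
  shows "inner_on (carrier G) (fourier_vec G x n s) (fourier_vec G x n t) = (if s = t then 1 else 0)"
proof -
  let ?z = "root_of_unity n ^ s * cnj (root_of_unity n ^ t)"
  have unit: "root_of_unity n ^ t * cnj (root_of_unity n ^ t) = 1"
    by (simp add: root_of_unity_power complex_norm_square[symmetric])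
  have "root_of_unity n ^ (s * a) / of_real (sqrt n) * cnj (root_of_unity n ^ (t * a) / of_real (sqrt n))
      = ?z ^ a / n" for a
  proof -
    have "complex_of_real (sqrt n) * of_real (sqrt n) = of_nat n"
      by (simp flip: of_real_mult)
    then show ?thesis
      by (simp add: power_mult power_mult_distrib)
  qed
  then have "inner_on (carrier G) (fourier_vec G x n s) (fourier_vec G x n t) = (\<Sum>a<n. ?z ^ a / n)"
    unfolding sum.reindex_bij_betw[OF bij_powers, symmetric]
    by (intro sum.cong refl) (simp add: fourier_vec_power)
  also have "\<dots> = (if ?z = 1 then 1 else 0)"
  proof -
    have "?z ^ n = (root_of_unity n ^ n) ^ s * cnj ((root_of_unity n ^ n) ^ t)"
      by (simp add: power_mult_distrib flip: power_mult) (simp add: mult.commute)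
    then have "?z ^ n = 1"
      using n_pos by (simp add: root_of_unity_power_n)
    from sum_powers_root_of_unity[OF this] show ?thesis
      using n_pos by (simp flip: sum_divide_distrib)
  qed
  also have "?z = 1 \<longleftrightarrow> s = t"
  proof
    assume "?z = 1"
    then have "root_of_unity n ^ s = root_of_unity n ^ t"
      using unit by (metis mult_cancel_right mult_zero_right zero_neq_one)
    then show "s = t"
      using assms root_of_unity_inj by blast
  qed (use unit in simp)
  finally show ?thesis .
qed

sublocale orthonormal_cubes "carrier G" "fourier_vec G x n" n "sqrt n"
  by unfold_locales (use finite_carrier fourier_orthonormal n_pos in auto)

text \<open>At the index with exponents \<open>a\<close>, \<open>b\<close>, \<open>c\<close>, both
  sides are the indicator of \<open>a + b + c\<close> being 0 modulo \<open>n\<close>: on the right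
  it appears as an average of powers of a root of unity.\<close>

lemma cyclic_tensor_eq_cube_sum: "cyclic_tensor G x n = cube_sum"
proof
  fix "is"
  show "cyclic_tensor G x n is = cube_sum is"
  proof (cases "is \<in> listset (group_algebra_cube G)")
    case False
    then show ?thesis
      by (simp add: cyclic_tensor_def cube_sum_def cube_def tensor_prod_def del: listset.simps)
  next
    case True
    then obtain g1 g2 g3 where g: "is = [g1, g2, g3]" "g1 \<in> carrier G" "g2 \<in> carrier G" "g3 \<in> carrier G"
      by (rule listset3E)
    moreover have "\<exists>a<n. g = x [^] a" if "g \<in> carrier G" for g
      using bij_powers that by (auto simp: bij_betw_def)
    ultimately obtain a b c where abc: "is = [x [^] a, x [^] b, x [^] c]" "a < n" "b < n" "c < n"
      by metis
    let ?I = "{(a, b, c). a < n \<and> b < n \<and> c < n \<and> (a + b + c) mod n = 0}"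
    have fin: "finite ?I"
      by (rule finite_subset[of _ "{..<n} \<times> {..<n} \<times> {..<n}"]) auto
    have "cyclic_tensor G x n is = (\<Sum>y\<in>?I. if y = (a, b, c) then 1 else 0)"
      unfolding cyclic_tensor_def using True abc
      by (intro sum.cong refl)
        (auto simp: tensor_prod_def basis_vec_def powers_eq_iff split: prod.splits)
    also have "\<dots> = (if (a + b + c) mod n = 0 then 1 else 0)"
      using fin abc by simp
    finally have l: "cyclic_tensor G x n is = (if (a + b + c) mod n = 0 then 1 else 0)" .
    let ?z = "root_of_unity n ^ (a + b + c)"
    \<comment> \<open>The three normalising factors \<open>1 / sqrt n\<close> against the weight
      \<open>sqrt n\<close> leave \<open>1 / n\<close>.\<close>
    have "of_real (sqrt n) * cube t is = ?z ^ t / n" for t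
    proof -
      have "complex_of_real (sqrt n) * of_real (sqrt n) = of_nat n"
        by (simp flip: of_real_mult)
      then show ?thesis
        using True abc n_pos
        by (simp add: cube_def tensor_prod_def fourier_vec_power field_simps power_add
            power_mult_distrib flip: power_mult)
    qed
    then have "cube_sum is = (\<Sum>t<n. ?z ^ t) / n"
      by (simp add: cube_sum_def sum_divide_distrib)
    also have "\<dots> = (if ?z = 1 then 1 else 0)"
    proof -
      have "?z ^ n = (root_of_unity n ^ n) ^ (a + b + c)"
        by (simp only: power_mult[symmetric] mult.commute)
      then have "?z ^ n = 1"
        using n_pos by (simp add: root_of_unity_power_n)
      from sum_powers_root_of_unity[OF this] show ?thesis
        using n_pos by simp
    qed
    finally show ?thesis
      using l root_of_unity_power_eq_1[OF n_pos] by simp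
  qed
qed

lemma fourier_decomposition_eq: "fourier_decomposition G x n = cube_decomposition"
  by (simp add: fourier_decomposition_def cube_decomposition_def cube_def)

end

theorem theorem1p13:
  fixes G :: "('a, 'b) monoid_scheme" and x :: 'a and n :: nat
  assumes "n \<ge> 1"
    and "group G" and "order G = n"
    and "x \<in> carrier G" and "generate G {x} = carrier G"
  shows "diagonal_svd (group_algebra_cube G) (cyclic_tensor G x n) (fourier_decomposition G x n)
    \<and> (\<forall>D. diagonal_svd (group_algebra_cube G) (cyclic_tensor G x n) D
            \<longrightarrow> mset D = mset (fourier_decomposition G x n))
    \<and> singular_values (group_algebra_cube G) (cyclic_tensor G x n) = replicate n (sqrt (real n))
    \<and> nuclear_norm (group_algebra_cube G) (cyclic_tensor G x n) = real n * sqrt (real n)"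
proof -
  interpret group G by fact
  interpret generated_cyclic_group G x n
    by unfold_locales (use assms in auto)
  show ?thesis
    unfolding cyclic_tensor_eq_cube_sum fourier_decomposition_eq
    using cube_decomposition_svd diagonal_svd_cube_sum_unique singular_values_cube_sum
      nuclear_norm_cube_sum by blast
qed

end
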